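(* Let $E$ be a finite-dimensional real vector space, $Q\subset E$ nonempty, convex and compact, and $h:Q\to\mathbb{R}$ concave and differentiable on $Q$, with finite curvature constant $C_{h,Q}$. Run the Frank-Wolfe method initiated with the pre-start step from a point $\lambda_0\in Q$ (which corresponds to $\bar\alpha_0=1$), and then with step-sizes $\bar\alpha_i=\frac{2}{i+2}$ for $i\ge1$. Then for all $k\ge1$: $$B_k-h(\lambda_{k+1})\le\frac{2C_{h,Q}}{k+4}\qquad\text{and}\qquad \min_{i\in\{1,\ldots,k\}}G_i\le\frac{4.5\,C_{h,Q}}{k}.$$
   Context: Notation: $E^*$ is the dual space of $E$, $s^T\lambda$ is the evaluation of $s\in E^*$ at $\lambda\in E$, $\nabla h(\lambda)\in E^*$, and $h^*=\max_{\lambda\in Q}h(\lambda)$. Curvature constant: $C_{h,Q}$ is the minimal $C$ such that $h(\lambda+\alpha(\bar\lambda-\lambda))\ge h(\lambda)+\nabla h(\lambda)^T(\alpha(\bar\lambda-\lambda))-\frac12 C\alpha^2$ for all $\lambda,\bar\lambda\in Q$ and all $\alpha\in[0,1]$ (assumed finite). Pre-start step: given $\lambda_0\in Q$ and an upper bound $B_{-1}\ge h^*$ (possibly $+\infty$), choose $\tilde\lambda_0\in\arg\max_{\lambda\in Q}\{h(\lambda_0)+\nabla h(\lambda_0)^T(\lambda-\lambda_0)\}$, set $B^w_0=h(\lambda_0)+\nabla h(\lambda_0)^T(\tilde\lambda_0-\lambda_0)$, $B_0=\min\{B_{-1},B^w_0,B^o_0\}$, and $\lambda_1=\tilde\lambda_0$.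 Frank-Wolfe method: at iteration $k\ge1$, choose $\tilde\lambda_k\in\arg\max_{\lambda\in Q}\{h(\lambda_k)+\nabla h(\lambda_k)^T(\lambda-\lambda_k)\}$; set $B^w_k=h(\lambda_k)+\nabla h(\lambda_k)^T(\tilde\lambda_k-\lambda_k)$ and the FW gap $G_k=\nabla h(\lambda_k)^T(\tilde\lambda_k-\lambda_k)$; set $B_k=\min\{B_{k-1},B^w_k,B^o_k\}$; set $\lambda_{k+1}=\lambda_k+\bar\alpha_k(\tilde\lambda_k-\lambda_k)$. Here each $B^o_k\ge h^*$ ($k\ge0$) is any other (optional) upper bound on $h^*$ (omitted, or $+\infty$, if not computed). *)

theory Defs
  imports "HOL-Analysis.Analysis"
begin

text \<open>
  The dual space of \<open>'e\<close> is \<open>'e \<Rightarrow>\<^sub>L real\<close>; in finite dimension every linear functional is bounded.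
\<close>

definition curvature_bound ::
  "'e::real_normed_vector set \<Rightarrow> ('e \<Rightarrow> real) \<Rightarrow> ('e \<Rightarrow> 'e \<Rightarrow>\<^sub>L real) \<Rightarrow> real \<Rightarrow> bool" where
  "curvature_bound Q h grad C \<longleftrightarrow>
     (\<forall>x\<in>Q. \<forall>y\<in>Q. \<forall>\<alpha>\<in>{0..1}.
        h (x + \<alpha> *\<^sub>R (y - x)) \<ge> h x + blinfun_apply (grad x) (\<alpha> *\<^sub>R (y - x)) - 1/2 * C * \<alpha>\<^sup>2)"

text \<open>The constant is finite iff some real number is a curvature bound.\<close>

definition curvature_const ::
  "'e::real_normed_vector set \<Rightarrow> ('e \<Rightarrow> real) \<Rightarrow> ('e \<Rightarrow> 'e \<Rightarrow>\<^sub>L real) \<Rightarrow> real" where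
  "curvature_const Q h grad = (LEAST C. curvature_bound Q h grad C)"

lemma curvature_const_least:
  assumes "Q \<noteq> {}" and "\<exists>C. curvature_bound Q h grad C"
  shows "curvature_bound Q h grad (curvature_const Q h grad) \<and>
    (\<forall>C. curvature_bound Q h grad C \<longrightarrow> curvature_const Q h grad \<le> C)"
proof -
  let ?S = "{C. curvature_bound Q h grad C}"
  have nonneg: "0 \<le> C" if "curvature_bound Q h grad C" for C
  proof -
    obtain x where "x \<in> Q" using assms(1) by blast
    with that have "h (x + 1 *\<^sub>R (x - x)) \<ge>
        h x + blinfun_apply (grad x) (1 *\<^sub>R (x - x)) - 1/2 * C * 1\<^sup>2"
      unfolding curvature_bound_def by (meson atLeastAtMost_iff order_refl zero_le_one)
    then show ?thesis by simp
  qed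
  have ne: "?S \<noteq> {}" using assms(2) by auto
  have bdd: "bdd_below ?S" using nonneg by (auto intro: bdd_belowI[of _ 0])
  have "curvature_bound Q h grad (Inf ?S)"
  proof (subst curvature_bound_def, intro ballI)
    fix x y and \<alpha> :: real
    assume xy: "x \<in> Q" "y \<in> Q" "\<alpha> \<in> {0..1}"
    let ?D = "h x + blinfun_apply (grad x) (\<alpha> *\<^sub>R (y - x)) - h (x + \<alpha> *\<^sub>R (y - x))"
    have D: "?D \<le> 1/2 * C * \<alpha>\<^sup>2" if "C \<in> ?S" for C
    proof -
      have "curvature_bound Q h grad C" using that by simp
      then show ?thesis using xy unfolding curvature_bound_def by force
    qed
    show "h (x + \<alpha> *\<^sub>R (y - x)) \<ge>
        h x + blinfun_apply (grad x) (\<alpha> *\<^sub>R (y - x)) - 1/2 * Inf ?S * \<alpha>\<^sup>2"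
    proof (cases "\<alpha> = 0")
      case False
      then have pos: "\<alpha>\<^sup>2 > 0" by simp
      have "2 * ?D / \<alpha>\<^sup>2 \<le> Inf ?S"
      proof (rule cInf_greatest[OF ne])
        fix C assume "C \<in> ?S"
        from D[OF this] pos show "2 * ?D / \<alpha>\<^sup>2 \<le> C"
          by (simp add: pos_divide_le_eq)
      qed
      then have "2 * ?D \<le> Inf ?S * \<alpha>\<^sup>2" using pos by (simp add: pos_divide_le_eq)
      then show ?thesis by simp
    next
      case True
      then show ?thesis by simp
    qed
  qed
  moreover have "Inf ?S \<le> C" if "curvature_bound Q h grad C" for C
    using that bdd by (auto intro: cInf_lower)
  ultimately have *: "curvature_bound Q h grad (Inf ?S)"
    "\<And>C. curvature_bound Q h grad C \<Longrightarrow> Inf ?S \<le> C" by auto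
  have "curvature_const Q h grad = Inf ?S"
    unfolding curvature_const_def by (rule Least_equality) (use * in auto)
  with * show ?thesis by simp
qed

definition max_value :: "'e set \<Rightarrow> ('e \<Rightarrow> real) \<Rightarrow> real" where
  "max_value Q h = (GREATEST v. v \<in> h ` Q)"

definition linear_model ::
  "('e::real_normed_vector \<Rightarrow> real) \<Rightarrow> ('e \<Rightarrow> 'e \<Rightarrow>\<^sub>L real) \<Rightarrow> 'e \<Rightarrow> 'e \<Rightarrow> real" where
  "linear_model h grad x y = h x + blinfun_apply (grad x) (y - x)"

definition fw_gap ::
  "('e::real_normed_vector \<Rightarrow> 'e \<Rightarrow>\<^sub>L real) \<Rightarrow> (nat \<Rightarrow> 'e) \<Rightarrow> (nat \<Rightarrow> 'e) \<Rightarrow> nat \<Rightarrow> real" where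
  "fw_gap grad lam lamt k = blinfun_apply (grad (lam k)) (lamt k - lam k)"

text \<open>
  A run of the Frank-Wolfe method with pre-start step.  Here \<open>lam\<close> are the iterates, \<open>lamt\<close> the
  chosen maximizers of the linear models, \<open>\<alpha>\<close> the step sizes (\<open>\<alpha> 0\<close> is not used), and \<open>B\<close> the upper
  bounds on the maximal value, with \<open>Bm1\<close> in the role of \<open>B (-1)\<close>.  The optional bounds \<open>Bo\<close> are
  \<open>\<infinity>\<close> where they are not computed.
\<close>

definition fw_prestart_run ::
  "'e::real_normed_vector set \<Rightarrow> ('e \<Rightarrow> real) \<Rightarrow> ('e \<Rightarrow> 'e \<Rightarrow>\<^sub>L real) \<Rightarrow> (nat \<Rightarrow> real) \<Rightarrow>
   ereal \<Rightarrow> (nat \<Rightarrow> ereal) \<Rightarrow> (nat \<Rightarrow> 'e) \<Rightarrow> (nat \<Rightarrow> 'e) \<Rightarrow> (nat \<Rightarrow> ereal) \<Rightarrow> bool" where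
  "fw_prestart_run Q h grad \<alpha> Bm1 Bo lam lamt B \<longleftrightarrow>
     lam 0 \<in> Q \<and>
     (\<forall>k. is_arg_max (linear_model h grad (lam k)) (\<lambda>x. x \<in> Q) (lamt k)) \<and>
     lam 1 = lamt 0 \<and>
     (\<forall>k\<ge>1. lam (k + 1) = lam k + \<alpha> k *\<^sub>R (lamt k - lam k)) \<and>
     B 0 = Min {Bm1, ereal (linear_model h grad (lam 0) (lamt 0)), Bo 0} \<and>
     (\<forall>k\<ge>1. B k = Min {B (k - 1), ereal (linear_model h grad (lam k) (lamt k)), Bo k})"

end

theory Submission
  imports Defs
begin

text \<open>
  The curvature bound turns the step from \<open>\<lambda>\<^sub>i\<close> to \<open>\<lambda>\<^sub>i\<^sub>+\<^sub>1\<close> into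
  \<open>h(\<lambda>\<^sub>i\<^sub>+\<^sub>1) \<ge> h(\<lambda>\<^sub>i) + \<alpha>\<^sub>i G\<^sub>i - C \<alpha>\<^sub>i\<^sup>2 / 2\<close>.  Since \<open>B\<^sub>i\<close> is at most the convex combination
  \<open>(1 - \<alpha>\<^sub>i) B\<^sub>i\<^sub>-\<^sub>1 + \<alpha>\<^sub>i (h(\<lambda>\<^sub>i) + G\<^sub>i)\<close>, the differences \<open>B\<^sub>i - h(\<lambda>\<^sub>i\<^sub>+\<^sub>1)\<close> contract by the factor
  \<open>1 - \<alpha>\<^sub>i\<close> up to an error \<open>C \<alpha>\<^sub>i\<^sup>2 / 2\<close>, which gives the first bound.  For the second bound, sum
  the same inequality over the second half \<open>l < i \<le> k\<close> of the iterations, \<open>l = \<lfloor>k/2\<rfloor>\<close>: the total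
  increase of \<open>h\<close> there is at most \<open>B\<^sub>l - h(\<lambda>\<^sub>l\<^sub>+\<^sub>1) \<le> 2C/(l+4)\<close>, which bounds the smallest gap.
\<close>

text \<open>Restrict \<open>h\<close> to the segment from \<open>x\<close> to \<open>y\<close>. By
  concavity every difference quotient at 0 is at least \<open>h y - h x\<close>, and the quotients
  tend to \<open>h' (y - x)\<close>. The one-sided limit suffices, so \<open>x\<close> may lie on
  the boundary of \<open>Q\<close>.\<close>

lemma concave_on_le_tangent:
  fixes h :: "'e::real_normed_vector \<Rightarrow> real"
  assumes conc: "concave_on Q h" and der: "(h has_derivative h') (at x within Q)"
    and x: "x \<in> Q" and y: "y \<in> Q"
  shows "h y \<le> h x + h' (y - x)"
proof -
  have cQ: "convex Q" using conc by (simp add: concave_on_def convex_on_def)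
  define p where "p t = x + t *\<^sub>R (y - x)" for t :: real
  have p_eq: "p t = (1 - t) *\<^sub>R x + t *\<^sub>R y" for t
    by (simp add: p_def algebra_simps)
  have pQ: "p ` {0..1} \<subseteq> Q"
    using cQ x y by (auto simp: p_eq convex_alt)
  have dp: "(p has_derivative (\<lambda>t. t *\<^sub>R (y - x))) (at 0 within {0..1})"
    unfolding p_def by (auto intro!: derivative_eq_intros)
  have "(h has_derivative h') (at (p 0) within p ` {0..1})"
    using has_derivative_subset[OF der pQ] by (simp add: p_def)
  from has_derivative_in_compose[OF dp this]
  have "((\<lambda>t. h (p t)) has_derivative (\<lambda>t. h' (t *\<^sub>R (y - x)))) (at 0 within {0..1})" .
  moreover have "h' (t *\<^sub>R (y - x)) = h' (y - x) * t" for t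
    using linear_scale[OF has_derivative_linear[OF der]] by simp
  ultimately have "((\<lambda>t. h (p t)) has_field_derivative h' (y - x)) (at 0 within {0..1})"
    by (simp add: has_field_derivative_def)
  then have lim: "((\<lambda>t. (h (p t) - h x) / t) \<longlongrightarrow> h' (y - x)) (at 0 within {0..1})"
    by (simp add: has_field_derivative_iff p_def)
  have "h y - h x \<le> h' (y - x)"
  proof (rule tendsto_lowerbound[OF lim])
    show "\<forall>\<^sub>F t in at 0 within {0..1}. h y - h x \<le> (h (p t) - h x) / t"
    proof (unfold eventually_at_filter, intro always_eventually allI impI)
      fix t :: real assume "t \<noteq> 0" "t \<in> {0..1}"
      then have "(1 - t) * h x + t * h y \<le> h (p t)"
        using concave_onD[OF conc, of t x y] x y by (simp add: p_eq)
      then have "(h y - h x) * t \<le> h (p t) - h x" by (simp add: algebra_simps)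
      with \<open>t \<noteq> 0\<close> \<open>t \<in> {0..1}\<close> show "h y - h x \<le> (h (p t) - h x) / t"
        by (subst pos_le_divide_eq) auto
    qed
  next
    show "at 0 within {0..1::real} \<noteq> bot"
      by (simp add: at_within_Icc_at_right)
  qed
  then show ?thesis by simp
qed

text \<open>Compactness makes the maximum attained, so that the \<open>GREATEST\<close> in
  \<open>max_value\<close> denotes it.\<close>

lemma le_max_value:
  assumes "compact Q" and "continuous_on Q h" and "x \<in> Q"
  shows "h x \<le> max_value Q h"
proof -
  obtain z where z: "z \<in> Q" "\<And>y. y \<in> Q \<Longrightarrow> h y \<le> h z"
    using continuous_attains_sup[of Q h] assms by blast
  then have "max_value Q h = h z"
    unfolding max_value_def by (intro Greatest_equality) auto
  with z assms(3) show ?thesis by simp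
qed

lemma max_value_le:
  assumes "compact Q" and "continuous_on Q h" and "Q \<noteq> {}" and "\<And>x. x \<in> Q \<Longrightarrow> h x \<le> u"
  shows "max_value Q h \<le> u"
proof -
  obtain z where z: "z \<in> Q" "\<And>y. y \<in> Q \<Longrightarrow> h y \<le> h z"
    using continuous_attains_sup[of Q h] assms by blast
  then have "max_value Q h = h z"
    unfolding max_value_def by (intro Greatest_equality) auto
  with z assms(4) show ?thesis by simp
qed

text \<open>Induction on \<open>k\<close>; at \<open>k = 0\<close> the claimed bound equals
  \<open>C / 2\<close>, exactly what the hypothesis on \<open>\<Delta> 0\<close> supplies.\<close>

lemma bound_gap_recursion:
  fixes \<Delta> :: "nat \<Rightarrow> real" and C :: real
  assumes C: "0 \<le> C" and init: "\<Delta> 0 \<le> C / 2"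
    and step: "\<And>i. i \<ge> 1 \<Longrightarrow>
      \<Delta> i \<le> (1 - 2 / (real i + 2)) * \<Delta> (i - 1) + C / 2 * (2 / (real i + 2))\<^sup>2"
  shows "\<Delta> k \<le> 2 * C / (real k + 4)"
proof (induction k)
  case 0
  then show ?case using init by simp
next
  case (Suc k)
  define x where "x = real k"
  have x: "x \<ge> 0" by (simp add: x_def)
  have "\<Delta> (Suc k) \<le> (1 - 2 / (x + 3)) * \<Delta> k + C / 2 * (2 / (x + 3))\<^sup>2"
    using step[of "Suc k"] by (simp add: x_def add.commute)
  also have "\<dots> \<le> (1 - 2 / (x + 3)) * (2 * C / (x + 4)) + C / 2 * (2 / (x + 3))\<^sup>2"
    using Suc x by (intro add_right_mono mult_left_mono) (auto simp: x_def field_simps)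
  also have "\<dots> = 2 * C * ((x\<^sup>2 + 5 * x + 7) / ((x + 4) * (x + 3)\<^sup>2))"
    using x by (simp add: divide_simps) (simp add: algebra_simps power2_eq_square)
  also have "\<dots> \<le> 2 * C * (1 / (x + 5))"
  proof (intro mult_left_mono)
    \<comment> \<open>The right side exceeds the left by \<open>x + 1\<close>.\<close>
    have "(x\<^sup>2 + 5 * x + 7) * (x + 5) \<le> (x + 4) * (x + 3)\<^sup>2"
      using x by (simp add: algebra_simps power2_eq_square)
    then show "(x\<^sup>2 + 5 * x + 7) / ((x + 4) * (x + 3)\<^sup>2) \<le> 1 / (x + 5)"
      using x by (simp add: divide_simps)
  qed (use C in auto)
  finally show ?case by (simp add: x_def add.commute)
qed

text \<open>
  The term \<open>2p/(2l+p+5)\<close> is the lower bound for \<open>\<Sum>i=l+1..l+p. 1/(i+2)\<close> given by the inequality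
  between harmonic and arithmetic mean; the last term telescopes \<open>1/(i+2)\<^sup>2 \<le> 1/(i+1) - 1/(i+2)\<close>.
\<close>

lemma window_increase:
  fixes v :: "nat \<Rightarrow> real" and C g :: real
  assumes C: "0 \<le> C" and g: "0 \<le> g"
    and step: "\<And>i. l < i \<Longrightarrow> i \<le> l + p \<Longrightarrow>
      v (i + 1) \<ge> v i + 2 / (real i + 2) * g - C / 2 * (2 / (real i + 2))\<^sup>2"
  shows "v (l + p + 1) - v (l + 1) \<ge>
    2 * g * (2 * real p / (2 * real l + real p + 5)) - 2 * C * (1 / (real l + 2) - 1 / (real l + real p + 2))"
  using step
proof (induction p)
  case 0
  then show ?case by simp
next
  case (Suc p)
  define x y where "x = real l" and "y = real p"
  have xy: "x \<ge> 0" "y \<ge> 0" by (simp_all add: x_def y_def)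
  have "v (l + p + 2) \<ge> v (l + p + 1) + 2 / (x + y + 3) * g - C / 2 * (2 / (x + y + 3))\<^sup>2"
    using Suc.prems[of "l + p + 1"] by (simp add: x_def y_def algebra_simps)
  moreover have "v (l + p + 1) - v (l + 1) \<ge>
      2 * g * (2 * y / (2 * x + y + 5)) - 2 * C * (1 / (x + 2) - 1 / (x + y + 2))"
    using Suc unfolding x_def y_def by auto
  moreover have "2 * g * (2 * (y + 1) / (2 * x + y + 6))
      \<le> 2 * g * (2 * y / (2 * x + y + 5) + 1 / (x + y + 3))"
  proof (intro mult_left_mono)
    \<comment> \<open>The growth of the harmonic-mean bound when the window gains one index; it must
      not exceed the new summand \<open>1 / (x + y + 3)\<close>.\<close>
    have "2 * (y + 1) / (2 * x + y + 6) - 2 * y / (2 * x + y + 5)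
        = (4 * x + 10) / ((2 * x + y + 6) * (2 * x + y + 5))"
      using xy by (simp add: divide_simps) (simp add: algebra_simps)
    also have "\<dots> \<le> 1 / (x + y + 3)"
    proof -
      \<comment> \<open>This is the difference of the two sides of the next inequality.\<close>
      have "0 \<le> y * y + y" using xy by simp
      then have "(4 * x + 10) * (x + y + 3) \<le> (2 * x + y + 6) * (2 * x + y + 5)"
        by (simp add: algebra_simps)
      then show ?thesis using xy by (simp add: divide_simps)
    qed
    finally show "2 * (y + 1) / (2 * x + y + 6) \<le> 2 * y / (2 * x + y + 5) + 1 / (x + y + 3)"
      by simp
  qed (use g in auto)
  moreover have "C / 2 * (2 / (x + y + 3))\<^sup>2 \<le> 2 * C * (1 / (x + y + 2) - 1 / (x + y + 3))"
  proof -
    have "(1 / (x + y + 3))\<^sup>2 \<le> 1 / (x + y + 2) - 1 / (x + y + 3)"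
    proof -
      have "1 / (x + y + 2) - 1 / (x + y + 3) = 1 / ((x + y + 2) * (x + y + 3))"
        using xy by (simp add: divide_simps)
      also have "\<dots> \<ge> 1 / ((x + y + 3) * (x + y + 3))"
        using xy by (intro divide_left_mono mult_right_mono mult_pos_pos) auto
      finally show ?thesis by (simp add: power2_eq_square)
    qed
    from mult_left_mono[OF this, of "2 * C"] C show ?thesis
      by (simp add: power_divide)
  qed
  ultimately have "v (l + p + 2) - v (l + 1) \<ge>
      2 * g * (2 * (y + 1) / (2 * x + y + 6)) - 2 * C * (1 / (x + 2) - 1 / (x + y + 3))"
    by (simp add: algebra_simps)
  then show ?case by (simp add: x_def y_def add.commute add.left_commute add.assoc)
qed

text \<open>With \<open>c\<close> and \<open>r\<close> below, \<open>bound\<close> reads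
  \<open>g * c \<le> C * r\<close>, so \<open>k * r \<le> 4.5 * c\<close> suffices. For
  \<open>l = p = k / 2\<close> and \<open>k\<close> large, \<open>k * r\<close> tends to 6 and
  \<open>c\<close> to 4/3, whence the constant 4.5.\<close>

lemma gap_constant_estimate:
  fixes C g :: real and k :: nat
  assumes C: "0 \<le> C" and "k \<ge> 1" and "l = k div 2" and "p = k - l"
    and bound: "2 * g * (2 * real p / (2 * real l + real p + 5))
      \<le> 2 * C / (real l + 4) + 2 * C * (1 / (real l + 2) - 1 / (real l + real p + 2))"
  shows "g \<le> 4.5 * C / real k"
proof -
  define x y where "x = real l" and "y = real p"
  have k: "real k = x + y" using assms by (simp add: x_def y_def)
  have x: "x \<ge> 0" by (simp add: x_def)
  have "p = l \<or> p = l + 1" using assms by linarith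
  then have y: "y = x \<or> y = x + 1" by (auto simp: x_def y_def)
  have "p \<ge> 1" using assms by linarith
  then have y1: "y \<ge> 1" by (simp add: y_def)
  define c where "c = 4 * y / (2 * x + y + 5)"
  define r where "r = 2 / (x + 4) + 2 * (1 / (x + 2) - 1 / (x + y + 2))"
  have c: "c > 0" using x y1 by (simp add: c_def)
  have gc: "g * c \<le> C * r"
    using bound by (simp add: c_def r_def x_def y_def algebra_simps)
  have "r * (x + y) \<le> 4.5 * c"
  proof -
    have "1 / (x + 2) - 1 / (x + y + 2) = y / ((x + 2) * (x + y + 2))"
      using x y1 by (simp add: divide_simps)
    then have r': "r = (2 * (x + 2) * (x + y + 2) + 2 * y * (x + 4)) / ((x + 4) * ((x + 2) * (x + y + 2)))"
      using x y1 by (simp add: r_def divide_simps)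
    \<comment> \<open>Denominators cleared, with \<open>18 = 4.5 * 4\<close>. For both parities of
      \<open>k\<close> the leading terms are \<open>36 * x^4\<close> on each side, and the right
      side dominates coefficient by coefficient.\<close>
    have "(2 * (x + 2) * (x + y + 2) + 2 * y * (x + 4)) * (x + y) * (2 * x + y + 5)
        \<le> 18 * y * ((x + 4) * ((x + 2) * (x + y + 2)))"
      using y
    proof
      assume "y = x"
      then show ?thesis using x
        by (simp add: algebra_simps power2_eq_square)
    next
      assume "y = x + 1"
      then show ?thesis using x
        by (simp add: algebra_simps power2_eq_square)
    qed
    then show ?thesis unfolding r' c_def using x y1
      by (simp add: divide_simps)
  qed
  then have "C * (r * (x + y)) \<le> C * (4.5 * c)" using C by (rule mult_left_mono)
  moreover have "g * c * (x + y) \<le> C * r * (x + y)"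
    using gc x y1 by (intro mult_right_mono) auto
  ultimately have "(g * (x + y)) * c \<le> (4.5 * C) * c" by (simp add: algebra_simps)
  then have "g * (x + y) \<le> 4.5 * C" using c by (rule mult_right_le_imp_le)
  then show ?thesis unfolding k using x y1 by (subst pos_le_divide_eq) auto
qed

theorem mainTheorem3:
  fixes Q :: "'e::real_normed_vector set"
    and h :: "'e \<Rightarrow> real"
    and grad :: "'e \<Rightarrow> 'e \<Rightarrow>\<^sub>L real"
    and \<alpha> :: "nat \<Rightarrow> real"
    and lam lamt :: "nat \<Rightarrow> 'e"
    and Bm1 :: ereal
    and Bo B :: "nat \<Rightarrow> ereal"
    and k :: nat
  assumes findim: "\<exists>S :: 'e set. finite S \<and> span S = UNIV"
    and "Q \<noteq> {}" and "convex Q" and "compact Q"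
    and "concave_on Q h"
    and "\<And>x. x \<in> Q \<Longrightarrow> (h has_derivative blinfun_apply (grad x)) (at x within Q)"
    and "\<exists>C. curvature_bound Q h grad C"
    and "ereal (max_value Q h) \<le> Bm1"
    and "\<And>i. ereal (max_value Q h) \<le> Bo i"
    and "\<And>i. i \<ge> 1 \<Longrightarrow> \<alpha> i = 2 / (real i + 2)"
    and "fw_prestart_run Q h grad \<alpha> Bm1 Bo lam lamt B"
    and "k \<ge> 1"
  shows "B k - ereal (h (lam (k + 1))) \<le> ereal (2 * curvature_const Q h grad / (real k + 4))
       \<and> Min (fw_gap grad lam lamt ` {1..k}) \<le> 4.5 * curvature_const Q h grad / real k"
proof -
  define C where "C = curvature_const Q h grad"
  define G where "G = fw_gap grad lam lamt"
  define v where "v i = h (lam i)" for i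
  note conv = \<open>convex Q\<close> and comp = \<open>compact Q\<close> and conc = \<open>concave_on Q h\<close>
  note der = assms(6) and Bm1 = assms(8) and Bo = assms(9) and \<alpha> = assms(10) and run = assms(11)

  \<comment> \<open>Feasibility of the iterates and increase of \<open>h\<close> along a
    step\<close>
  have curv: "curvature_bound Q h grad C"
    using curvature_const_least[OF assms(2,7)] by (simp add: C_def)
  have cont: "continuous_on Q h"
    using der by (meson continuous_on_eq_continuous_within has_derivative_continuous)
  have lamt: "lamt i \<in> Q" and lamt_max: "x \<in> Q \<Longrightarrow>
      linear_model h grad (lam i) x \<le> linear_model h grad (lam i) (lamt i)" for i x
    using run by (auto simp: fw_prestart_run_def is_arg_max_linorder)
  have lam1: "lam 1 = lamt 0"
    and lam_step: "\<And>i. i \<ge> 1 \<Longrightarrow> lam (i + 1) = lam i + (2 / (real i + 2)) *\<^sub>R (lamt i - lam i)"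
    using run \<alpha> by (auto simp: fw_prestart_run_def)
  have unit: "2 / (real i + 2) \<in> {0..1}" for i by simp
  have lamQ: "lam i \<in> Q" for i
  proof (induction i)
    case 0
    then show ?case using run by (simp add: fw_prestart_run_def)
  next
    case (Suc i)
    show ?case
    proof (cases "i = 0")
      case True
      then show ?thesis using lam1 lamt by simp
    next
      case False
      then have "lam (Suc i) = (1 - 2 / (real i + 2)) *\<^sub>R lam i + (2 / (real i + 2)) *\<^sub>R lamt i"
        using lam_step[of i] by (simp add: algebra_simps)
      then show ?thesis using conv Suc lamt[of i] unit[of i] by (simp add: convex_alt)
    qed
  qed
  have ascent: "h (lam i + t *\<^sub>R (lamt i - lam i)) \<ge> v i + t * G i - C / 2 * t\<^sup>2"
    if "t \<in> {0..1}" for i t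
    using curv lamQ[of i] lamt[of i] that
    by (auto simp: curvature_bound_def v_def G_def fw_gap_def blinfun.scaleR_right)
  \<comment> \<open>At two equal points and step 1 the curvature inequality reduces to
    \<open>0 \<ge> - C / 2\<close>.\<close>
  have C: "0 \<le> C"
    using curv lamt[of 0] by (force simp: curvature_bound_def dest!: bspec[where x = "lamt 0"] bspec[where x = 1])
  have step: "v (i + 1) \<ge> v i + 2 / (real i + 2) * G i - C / 2 * (2 / (real i + 2))\<^sup>2"
    if "i \<ge> 1" for i
    using ascent[OF unit, of i i] lam_step[OF that] by (simp add: v_def)
  have G_nonneg: "0 \<le> G i" for i
    using lamt_max[OF lamQ, of i i] by (simp add: linear_model_def G_def fw_gap_def)
  have model: "linear_model h grad (lam i) (lamt i) = v i + G i" for i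
    by (simp add: linear_model_def v_def G_def fw_gap_def)
  \<comment> \<open>A concave function lies below its tangents, so the maximum of each linear model
    is a valid upper bound; hence so is every \<open>B i\<close>.\<close>
  have max_le_model: "max_value Q h \<le> v i + G i" for i
  proof (rule max_value_le[OF comp cont \<open>Q \<noteq> {}\<close>])
    fix x assume x: "x \<in> Q"
    have "h x \<le> linear_model h grad (lam i) x"
      unfolding linear_model_def by (rule concave_on_le_tangent[OF conc der lamQ x]) (rule lamQ)
    also have "\<dots> \<le> v i + G i" using lamt_max[OF x, of i] by (simp add: model)
    finally show "h x \<le> v i + G i" .
  qed
  have B0: "B 0 = Min {Bm1, ereal (v 0 + G 0), Bo 0}"
    and B_step: "\<And>i. i \<ge> 1 \<Longrightarrow> B i = Min {B (i - 1), ereal (v i + G i), Bo i}"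
    using run by (auto simp: fw_prestart_run_def model)
  have max_le_B: "ereal (max_value Q h) \<le> B i" for i
  proof (induction i)
    case 0
    then show ?case using Bm1 Bo[of 0] max_le_model[of 0] by (simp add: B0)
  next
    case (Suc i)
    then show ?case using Bo[of "Suc i"] max_le_model[of "Suc i"] by (simp add: B_step)
  qed
  have B_le_model: "B i \<le> ereal (v i + G i)" for i
    by (cases "i = 0") (simp_all add: B0 B_step min_le_iff_disj)
  \<comment> \<open>Each \<open>B i\<close> lies between two reals, the maximal value and the model
    value, so the conversion to \<open>real\<close> loses nothing.\<close>
  define b where "b i = real_of_ereal (B i)" for i
  have "\<bar>B i\<bar> \<noteq> \<infinity>" for i
    using max_le_B[of i] B_le_model[of i] by (cases "B i") auto
  then have b: "B i = ereal (b i)" for i by (simp add: b_def ereal_real')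
  have b_le_model: "b i \<le> v i + G i" for i using B_le_model[of i] by (simp add: b)
  have b_mono: "b i \<le> b (i - 1)" if "i \<ge> 1" for i
  proof -
    have "B i \<le> B (i - 1)" using B_step[OF that] by simp
    then show ?thesis by (simp add: b)
  qed

  \<comment> \<open>Contraction of the bound gap\<close>
  have bound: "b i - v (i + 1) \<le> 2 * C / (real i + 4)" for i
  proof (rule bound_gap_recursion[OF C])
    \<comment> \<open>The pre-start step is a full step, so \<open>ascent\<close> applies with
      \<open>t = 1\<close>.\<close>
    show "b 0 - v (0 + 1) \<le> C / 2"
      using ascent[of 1 0] b_le_model[of 0] lam1 by (simp add: v_def)
  next
    fix i :: nat assume i: "i \<ge> 1"
    define t where "t = 2 / (real i + 2)"
    have t: "0 \<le> t" "t \<le> 1" using unit[of i] by (simp_all add: t_def)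
    have "b i = (1 - t) * b i + t * b i" by (simp add: algebra_simps)
    also have "\<dots> \<le> (1 - t) * b (i - 1) + t * (v i + G i)"
      using t b_mono[OF i] b_le_model[of i] by (intro add_mono mult_left_mono) auto
    finally have "b i - v (i + 1) \<le> (1 - t) * (b (i - 1) - v i) + C / 2 * t\<^sup>2"
      using step[OF i] by (simp add: t_def[symmetric] algebra_simps)
    \<comment> \<open>Since \<open>i \<ge> 1\<close>, the natural number \<open>i - 1 + 1\<close> is
      \<open>i\<close>.\<close>
    then show "b i - v (i + 1) \<le> (1 - 2 / (real i + 2)) * (b (i - 1) - v (i - 1 + 1))
        + C / 2 * (2 / (real i + 2))\<^sup>2"
      using i by (simp add: t_def)
  qed

  \<comment> \<open>The smallest gap\<close>
  define g where "g = Min (G ` {1..k})"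
  define l where "l = k div 2"
  define p where "p = k - l"
  have lp: "l + p = k" by (simp add: l_def p_def)
  have g_nonneg: "0 \<le> g"
    using G_nonneg \<open>k \<ge> 1\<close> by (simp add: g_def)
  have g_step: "v (i + 1) \<ge> v i + 2 / (real i + 2) * g - C / 2 * (2 / (real i + 2))\<^sup>2"
    if "l < i" "i \<le> l + p" for i
  proof -
    have "g \<le> G i" using that lp by (simp add: g_def)
    then have "2 / (real i + 2) * g \<le> 2 / (real i + 2) * G i"
      by (intro mult_left_mono) auto
    with step[of i] that show ?thesis by simp
  qed
  \<comment> \<open>The bound \<open>b l\<close> precedes the window, so the first estimate at
    \<open>l\<close> limits the increase over it. For \<open>k = 1\<close> this is the pre-start
    bound \<open>b 0\<close>.\<close>
  have "v (l + p + 1) \<le> b l"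
    using le_max_value[OF comp cont lamQ, of "l + p + 1"] max_le_B[of l] by (simp add: b v_def)
  moreover have "v (l + p + 1) - v (l + 1) \<ge> 2 * g * (2 * real p / (2 * real l + real p + 5))
      - 2 * C * (1 / (real l + 2) - 1 / (real l + real p + 2))"
    by (rule window_increase[OF C g_nonneg g_step])
  ultimately have "2 * g * (2 * real p / (2 * real l + real p + 5))
      \<le> 2 * C / (real l + 4) + 2 * C * (1 / (real l + 2) - 1 / (real l + real p + 2))"
    using bound[of l] by linarith
  then have "g \<le> 4.5 * C / real k"
    by (rule gap_constant_estimate[OF C \<open>k \<ge> 1\<close> l_def p_def])
  with bound[of k] show ?thesis
    by (simp add: b v_def g_def G_def C_def)
qed

end
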